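(* Let $1<p<\infty$, let $v$ be a weight function on $\mathbb{R}$, and let $\phi\in L^1(\mathbb{R})$ be such that $$A_{\sup}:=\int_{\mathbb{R}} \frac{|\phi(t)|}{|t|^{2\alpha+2-\frac1p}}\left(\sup_{y\in\mathbb{R}}\frac{v(ty)}{v(y)}\right)^{1/p}dt<\infty .$$ Then the operator $H_{\alpha,\phi}$ is a bounded operator on $L^p_v(\mathbb{R})$ and, for every $f\in L^p_v(\mathbb{R})$, $$\|H_{\alpha,\phi}f\|_{L^p_v(\mathbb{R})}\le A_{\sup}\,\|f\|_{L^p_v(\mathbb{R})}.$$
   Context: A weight function is a function which is measurable, positive and finite almost everywhere on its domain. $L^p_v(\mathbb{R})$ is the weighted Lebesgue space with norm $\|f\|_{L^p_v(\mathbb{R})}=\left(\int_{\mathbb{R}}|f(x)|^p v(x)\,dx\right)^{1/p}$. For a real parameter $\alpha$ and $\phi\in L^1(\mathbb{R})$, the Dunkl-Hausdorff operator is $$H_{\alpha,\phi}f(x)=\int_{\mathbb{R}}\frac{|\phi(t)|}{|t|^{2\alpha+2}}f\left(\frac{x}{t}\right)dt .$$ *)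

theory Defs
  imports "HOL-Analysis.Analysis"
begin

text \<open>
  A weight takes values in \<open>[0, \<infinity>]\<close>; the exceptional null set on which it is
  \<open>0\<close> or \<open>\<infinity>\<close> is allowed. Measurability is Lebesgue measurability throughout.
\<close>

definition weight_function :: "(real \<Rightarrow> ennreal) \<Rightarrow> bool" where
  "weight_function v \<longleftrightarrow>
     v \<in> borel_measurable lebesgue \<and> (AE x in lebesgue. 0 < v x \<and> v x < \<infinity>)"

text \<open>The power \<open>a\<^sup>s\<close> for \<open>a \<in> [0, \<infinity>]\<close>; meant for \<open>s > 0\<close> only.\<close>

definition ennreal_powr :: "ennreal \<Rightarrow> real \<Rightarrow> ennreal" where
  "ennreal_powr a s = (if a = \<infinity> then \<infinity> else ennreal (enn2real a powr s))"

definition Lpv_norm :: "real \<Rightarrow> (real \<Rightarrow> ennreal) \<Rightarrow> (real \<Rightarrow> complex) \<Rightarrow> ennreal" where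
  "Lpv_norm p v f =
     ennreal_powr (\<integral>\<^sup>+x. ennreal (norm (f x) powr p) * v x \<partial>lebesgue) (1 / p)"

text \<open>Elements are functions; the identification of functions that agree almost everywhere
  is made in \<open>bounded_operator_Lpv\<close>.\<close>

definition Lpv :: "real \<Rightarrow> (real \<Rightarrow> ennreal) \<Rightarrow> (real \<Rightarrow> complex) set" where
  "Lpv p v = {f \<in> borel_measurable lebesgue. Lpv_norm p v f < \<infinity>}"

text \<open>\<open>T\<close> maps the space to itself, respects almost everywhere equality, and induces a
  bounded linear operator on the classes. Since a weight vanishes only on a null set,
  equality of classes is almost everywhere equality for Lebesgue measure.\<close>

definition bounded_operator_Lpv ::
  "real \<Rightarrow> (real \<Rightarrow> ennreal) \<Rightarrow> ((real \<Rightarrow> complex) \<Rightarrow> real \<Rightarrow> complex) \<Rightarrow> bool" where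
  "bounded_operator_Lpv p v T \<longleftrightarrow>
     (\<forall>f\<in>Lpv p v. T f \<in> Lpv p v) \<and>
     (\<forall>f\<in>Lpv p v. \<forall>g\<in>Lpv p v.
        (AE x in lebesgue. f x = g x) \<longrightarrow> (AE x in lebesgue. T f x = T g x)) \<and>
     (\<forall>f\<in>Lpv p v. \<forall>g\<in>Lpv p v. AE x in lebesgue. T (\<lambda>y. f y + g y) x = T f x + T g x) \<and>
     (\<forall>c. \<forall>f\<in>Lpv p v. AE x in lebesgue. T (\<lambda>y. c * f y) x = c * T f x) \<and>
     (\<exists>C::real. 0 \<le> C \<and> (\<forall>f\<in>Lpv p v. Lpv_norm p v (T f) \<le> ennreal C * Lpv_norm p v f))"

definition dunkl_hausdorff_integrand ::
  "real \<Rightarrow> (real \<Rightarrow> complex) \<Rightarrow> (real \<Rightarrow> complex) \<Rightarrow> real \<Rightarrow> real \<Rightarrow> complex" where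
  "dunkl_hausdorff_integrand \<alpha> \<phi> f x t =
     complex_of_real (norm (\<phi> t) / \<bar>t\<bar> powr (2 * \<alpha> + 2)) * f (x / t)"

text \<open>The Bochner integral is \<open>0\<close> by convention where the integrand is not integrable, so
  existence of the integral for almost every \<open>x\<close> has to be claimed separately.\<close>

definition dunkl_hausdorff ::
  "real \<Rightarrow> (real \<Rightarrow> complex) \<Rightarrow> (real \<Rightarrow> complex) \<Rightarrow> real \<Rightarrow> complex" where
  "dunkl_hausdorff \<alpha> \<phi> f x = (LINT t|lebesgue. dunkl_hausdorff_integrand \<alpha> \<phi> f x t)"

text \<open>The supremum is the pointwise one over all real \<open>y\<close>. The quotient is that of
  \<open>ennreal\<close>: \<open>a / 0 = \<infinity>\<close> for \<open>a > 0\<close> and \<open>0 / 0 = \<infinity> / \<infinity> = 0\<close>, which only concerns \<open>y\<close> in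
  a null set for each \<open>t \<noteq> 0\<close>. The supremum need not be measurable in \<open>t\<close>; then
  \<open>nn_integral\<close> is the lower integral.\<close>

definition A_sup :: "real \<Rightarrow> real \<Rightarrow> (real \<Rightarrow> ennreal) \<Rightarrow> (real \<Rightarrow> complex) \<Rightarrow> ennreal" where
  "A_sup \<alpha> p v \<phi> =
     (\<integral>\<^sup>+t. ennreal (norm (\<phi> t) / \<bar>t\<bar> powr (2 * \<alpha> + 2 - 1 / p))
            * ennreal_powr (SUP y. v (t * y) / v y) (1 / p) \<partial>lebesgue)"

end

theory Submission
  imports Defs
begin

text \<open>
  The operator is an average over \<open>t\<close> of the dilates \<open>x \<mapsto> f (x / t)\<close>, with the nonnegative
  weight \<open>K(t) = |\<phi>(t)| / |t| powr (2\<alpha> + 2)\<close>. Minkowski's integral inequality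
  (\<open>Minkowski_nn_integral\<close>) therefore bounds the norm of \<open>H f\<close> by the integral of \<open>K(t)\<close> times
  the norm of the dilate. The substitution \<open>x = t y\<close> turns the \<open>p\<close>-th power of that norm into
  \<open>|t| \<integral> |f(y)|\<^sup>p v(t y) dy\<close>, and \<open>v(t y)\<close> is at most \<open>S(t) v(y)\<close> for
  \<open>S(t) = sup v(t y) / v(y)\<close> and almost every \<open>y\<close>. So the dilate has norm at most
  \<open>|t| powr (1 / p) S(t) powr (1 / p)\<close> times the norm of \<open>f\<close>
  (\<open>weighted_norm_dilation_le\<close>), and integrating against \<open>K\<close> gives exactly \<open>A_sup\<close>. The same
  estimate, applied with absolute values inside the integral, shows that the integral defining
  \<open>H f (x)\<close> converges absolutely for almost every \<open>x\<close>, because the weight is positive almost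
  everywhere; linearity follows from this.

  Two points of measure theory need care. For a Lebesgue measurable \<open>f\<close> the function
  \<open>(x, t) \<mapsto> f (x / t)\<close> need not be measurable for the product of the Lebesgue \<open>\<sigma>\<close>-algebras, which
  Tonelli's theorem asks for. So \<open>f\<close>, \<open>v\<close> and \<open>\<phi>\<close> are replaced by Borel functions equal to them
  almost everywhere; for \<open>x \<noteq> 0\<close> this changes the integrand only for \<open>t\<close> in a null set, because
  \<open>t \<mapsto> x / t\<close> preserves null sets (\<open>dunkl_hausdorff_borel_versions\<close>). Secondly, \<open>S\<close> need not be
  measurable, and \<open>A_sup\<close> is then a lower integral. It still dominates the integral of any
  measurable function below its integrand, and the norms of the dilates depend measurably on \<open>t\<close>
  by Tonelli's theorem (\<open>nn_integral_le_multc\<close>).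
\<close>

section \<open>Powers of extended nonnegative reals\<close>

lemma ennreal_powr_ennreal: "0 \<le> x \<Longrightarrow> ennreal_powr (ennreal x) s = ennreal (x powr s)"
  by (simp add: ennreal_powr_def)

lemma ennreal_powr_0 [simp]: "ennreal_powr 0 s = 0"
  by (simp add: ennreal_powr_def)

lemma ennreal_powr_top [simp]: "ennreal_powr top s = top"
  by (simp add: ennreal_powr_def)

lemma ennreal_powr_1 [simp]: "ennreal_powr a 1 = a"
  by (cases a) (simp_all add: ennreal_powr_ennreal)

lemma ennreal_powr_eq_0_iff [simp]: "ennreal_powr a s = 0 \<longleftrightarrow> a = 0"
  by (cases a) (simp_all add: ennreal_powr_ennreal)

lemma ennreal_powr_eq_top_iff [simp]: "ennreal_powr a s = top \<longleftrightarrow> a = top"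
  by (cases a) (simp_all add: ennreal_powr_ennreal)

lemma ennreal_powr_mono:
  assumes "a \<le> b" "0 < s"
  shows "ennreal_powr a s \<le> ennreal_powr b s"
  using assms by (cases a; cases b) (auto simp: ennreal_powr_ennreal top_unique intro!: ennreal_leI powr_mono2)

lemma ennreal_powr_mult: "ennreal_powr (a * b) s = ennreal_powr a s * ennreal_powr b s"
  by (cases a; cases b)
     (auto simp: ennreal_powr_ennreal powr_mult ennreal_mult_top ennreal_top_mult
           simp flip: ennreal_mult)

lemma ennreal_powr_powr: "ennreal_powr (ennreal_powr a s) t = ennreal_powr a (s * t)"
  by (cases a) (simp_all add: ennreal_powr_ennreal powr_powr)

lemma ennreal_powr_add: "ennreal_powr a s * ennreal_powr a t = ennreal_powr a (s + t)"
  by (cases a) (simp_all add: ennreal_powr_ennreal powr_add ennreal_mult)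

lemma ennreal_powr_inverse:
  "ennreal_powr (inverse a) s = inverse (ennreal_powr a s)"
proof (cases a)
  case (real r)
  then show ?thesis
    by (cases "r = 0") (simp_all add: ennreal_powr_ennreal inverse_ennreal inverse_powr)
qed simp

lemma borel_measurable_ennreal_powr [measurable (raw)]:
  assumes [measurable]: "f \<in> borel_measurable M"
  shows "(\<lambda>x. ennreal_powr (f x) s) \<in> borel_measurable M"
  unfolding ennreal_powr_def by measurable

lemma ennreal_inverse_mult_self_le_one: "inverse a * a \<le> (1::ennreal)"
proof (cases a)
  case (real r)
  then show ?thesis
    by (cases "r = 0") (simp_all add: inverse_ennreal flip: ennreal_mult)
qed simp

section \<open>The inequalities of Hoelder and Minkowski\<close>

lemma Youngs_inequality_ennreal:
  assumes "1 < p" "1 < q" "1 / p + 1 / q = 1"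
  shows "a * b \<le> ennreal (1 / p) * ennreal_powr a p + ennreal (1 / q) * ennreal_powr b q"
proof (cases "a = top \<or> b = top")
  case True
  then show ?thesis
    using assms by (auto simp: ennreal_mult_top)
next
  case False
  then obtain x y where "a = ennreal x" "0 \<le> x" "b = ennreal y" "0 \<le> y"
    by (metis ennreal_cases)
  then show ?thesis
    using Youngs_inequality[OF assms, of x y] assms
    by (simp add: ennreal_powr_ennreal ennreal_leI flip: ennreal_mult ennreal_plus)
qed

text \<open>
  After dividing \<open>f\<close> and \<open>g\<close> by their norms, Young's inequality integrates to \<open>1 / p + 1 / q = 1\<close>.
  When a norm is \<open>0\<close> or infinite this normalisation is impossible, but then either the product
  vanishes almost everywhere or the right-hand side is infinite.
\<close>

lemma Holder_nn_integral:
  fixes f g :: "'a \<Rightarrow> ennreal"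
  assumes pq: "1 < p" "1 < q" "1 / p + 1 / q = 1"
    and [measurable]: "f \<in> borel_measurable M" "g \<in> borel_measurable M"
  shows "(\<integral>\<^sup>+x. f x * g x \<partial>M) \<le>
    ennreal_powr (\<integral>\<^sup>+x. ennreal_powr (f x) p \<partial>M) (1 / p) *
    ennreal_powr (\<integral>\<^sup>+x. ennreal_powr (g x) q \<partial>M) (1 / q)"
    (is "_ \<le> ennreal_powr ?F _ * ennreal_powr ?G _")
proof -
  consider "?F = 0" | "?G = 0" | "?F = top" "?G \<noteq> 0" | "?F \<noteq> 0" "?G = top"
    | "?F \<noteq> 0" "?F \<noteq> top" "?G \<noteq> 0" "?G \<noteq> top"
    by blast
  then show ?thesis
  proof cases
    case 1
    then have "AE x in M. f x = 0"
      by (subst (asm) nn_integral_0_iff_AE) simp_all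
    then have "(\<integral>\<^sup>+x. f x * g x \<partial>M) = (\<integral>\<^sup>+x. 0 \<partial>M)"
      by (intro nn_integral_cong_AE) auto
    then show ?thesis by simp
  next
    case 2
    then have "AE x in M. g x = 0"
      by (subst (asm) nn_integral_0_iff_AE) simp_all
    then have "(\<integral>\<^sup>+x. f x * g x \<partial>M) = (\<integral>\<^sup>+x. 0 \<partial>M)"
      by (intro nn_integral_cong_AE) auto
    then show ?thesis by simp
  next
    case 3
    then show ?thesis by (simp add: ennreal_top_mult)
  next
    case 4
    then show ?thesis by (simp add: ennreal_mult_top)
  next
    case 5
    define a where "a = ennreal_powr ?F (1 / p)"
    define b where "b = ennreal_powr ?G (1 / q)"
    have ab: "a \<noteq> 0" "a \<noteq> top" "b \<noteq> 0" "b \<noteq> top"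
      using 5 by (simp_all add: a_def b_def)
    have one: "c * inverse c = 1" if "c \<noteq> 0" "c \<noteq> top" for c :: ennreal
      using that by (metis divide_ennreal_def ennreal_divide_self less_top)
    have ap: "ennreal_powr a p = ?F" and bq: "ennreal_powr b q = ?G"
      using pq by (simp_all add: a_def b_def ennreal_powr_powr)
    have "(\<integral>\<^sup>+x. f x * g x \<partial>M) = (\<integral>\<^sup>+x. (a * b) * ((f x * inverse a) * (g x * inverse b)) \<partial>M)"
    proof (rule nn_integral_cong)
      fix x
      have "(a * b) * ((f x * inverse a) * (g x * inverse b)) =
          (a * inverse a) * (b * inverse b) * (f x * g x)"
        by (simp only: mult_ac)
      then show "f x * g x = (a * b) * ((f x * inverse a) * (g x * inverse b))"
        using ab by (simp add: one)
    qed
    also have "\<dots> \<le> (\<integral>\<^sup>+x. (a * b) * (ennreal (1 / p) * (ennreal_powr (f x) p * inverse ?F) +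
        ennreal (1 / q) * (ennreal_powr (g x) q * inverse ?G)) \<partial>M)"
      using Youngs_inequality_ennreal[OF pq, of "f _ * inverse a" "g _ * inverse b"]
      by (intro nn_integral_mono mult_left_mono)
         (simp_all add: ennreal_powr_mult ennreal_powr_inverse ap bq)
    also have "\<dots> = (a * b) * (ennreal (1 / p) * (?F * inverse ?F) + ennreal (1 / q) * (?G * inverse ?G))"
      by (simp add: nn_integral_cmult nn_integral_add nn_integral_multc)
    also have "\<dots> = a * b"
      using 5 pq by (simp add: one flip: ennreal_plus)
    finally show ?thesis
      by (simp add: a_def b_def)
  qed
qed

context pair_sigma_finite
begin

text \<open>
  Let \<open>N(t)\<close> be the norm of \<open>g(\<cdot>, t)\<close> and \<open>A = \<integral> N\<close>. Instead of testing against the dual space,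
  apply Hoelder's inequality in \<open>t\<close>, for fixed \<open>x\<close>, to \<open>g = (g N powr (- 1 / q)) N powr (1 / q)\<close>:
  \<open>(\<integral> g(x, t) dt)\<^sup>p \<le> A powr (p - 1) \<integral> g(x, t)\<^sup>p N(t) powr (1 - p) dt\<close>.
  Integrating over \<open>x\<close> and using Tonelli's theorem, the inner integral of \<open>g\<^sup>p\<close> becomes \<open>N\<^sup>p\<close>, so that
  the right-hand side is at most \<open>A powr (p - 1) \<integral> N = A\<^sup>p\<close>.
\<close>

lemma Minkowski_nn_integral:
  fixes g :: "'a \<Rightarrow> 'b \<Rightarrow> ennreal"
  assumes p: "1 < p"
    and [measurable]: "case_prod g \<in> borel_measurable (M1 \<Otimes>\<^sub>M M2)"
  shows "ennreal_powr (\<integral>\<^sup>+x. ennreal_powr (\<integral>\<^sup>+t. g x t \<partial>M2) p \<partial>M1) (1 / p) \<le>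
    (\<integral>\<^sup>+t. ennreal_powr (\<integral>\<^sup>+x. ennreal_powr (g x t) p \<partial>M1) (1 / p) \<partial>M2)"
    (is "_ \<le> ?A")
proof (cases "?A = top")
  case False
  define N where "N t = ennreal_powr (\<integral>\<^sup>+x. ennreal_powr (g x t) p \<partial>M1) (1 / p)" for t
  define q where "q = p / (p - 1)"
  have q: "1 < q" "1 / p + 1 / q = 1" "1 / q * p = p - 1"
    using p by (simp_all add: q_def field_simps)
  have [measurable]: "N \<in> borel_measurable M2"
    unfolding N_def by measurable
  have Np: "(\<integral>\<^sup>+x. ennreal_powr (g x t) p \<partial>M1) = ennreal_powr (N t) p" for t
    using p by (simp add: N_def ennreal_powr_powr)
  have A: "(\<integral>\<^sup>+t. N t \<partial>M2) = ?A"
    by (simp add: N_def)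
  have fin: "AE t in M2. N t \<noteq> top"
    using False unfolding A[symmetric] by (intro nn_integral_noteq_infinite[unfolded infinity_ennreal_def]) simp_all
  \<comment> \<open>The factorisation of \<open>g\<close> fails where \<open>N\<close> vanishes, but there \<open>g\<close> vanishes almost everywhere.\<close>
  have "(\<integral>\<^sup>+x. (\<integral>\<^sup>+t. indicator {0} (N t) * ennreal_powr (g x t) p \<partial>M2) \<partial>M1) =
      (\<integral>\<^sup>+t. (\<integral>\<^sup>+x. indicator {0} (N t) * ennreal_powr (g x t) p \<partial>M1) \<partial>M2)"
    by (rule Fubini'[symmetric]) measurable
  also have "\<dots> = (\<integral>\<^sup>+t. 0 \<partial>M2)"
    by (intro nn_integral_cong) (auto simp: nn_integral_cmult Np indicator_def)
  also have "\<dots> = 0"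
    by simp
  finally have "AE x in M1. (\<integral>\<^sup>+t. indicator {0} (N t) * ennreal_powr (g x t) p \<partial>M2) = 0"
    by (subst (asm) nn_integral_0_iff_AE) simp_all
  moreover have "AE x in M1. x \<in> space M1"
    by simp
  ultimately have zero: "AE x in M1. AE t in M2. N t = 0 \<longrightarrow> g x t = 0"
  proof eventually_elim
    case (elim x)
    note [measurable] = \<open>x \<in> space M1\<close>
    from elim have "AE t in M2. indicator {0} (N t) * ennreal_powr (g x t) p = 0"
      by (subst (asm) nn_integral_0_iff_AE) simp_all
    then show ?case by eventually_elim (auto simp: indicator_def)
  qed
  have "AE x in M1. ennreal_powr (\<integral>\<^sup>+t. g x t \<partial>M2) p \<le>
      (\<integral>\<^sup>+t. ennreal_powr (g x t) p * inverse (ennreal_powr (N t) (p - 1)) \<partial>M2) * ennreal_powr ?A (p - 1)"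
    using zero AE_space
  proof eventually_elim
    case (elim x)
    note [measurable] = \<open>x \<in> space M1\<close>
    have "(\<integral>\<^sup>+t. g x t \<partial>M2) =
        (\<integral>\<^sup>+t. (g x t * inverse (ennreal_powr (N t) (1 / q))) * ennreal_powr (N t) (1 / q) \<partial>M2)"
    proof (rule nn_integral_cong_AE)
      show "AE t in M2. g x t =
          (g x t * inverse (ennreal_powr (N t) (1 / q))) * ennreal_powr (N t) (1 / q)"
        using elim(1) fin
      proof eventually_elim
        case (elim t)
        let ?w = "ennreal_powr (N t) (1 / q)"
        have "?w / ?w = 1" if "N t \<noteq> 0"
          using elim that by (intro ennreal_divide_self) (simp_all add: less_top[symmetric])
        then show ?case
          using elim by (cases "N t = 0") (simp_all add: divide_ennreal_def mult_ac)
      qed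
    qed
    also have "\<dots> \<le>
        ennreal_powr (\<integral>\<^sup>+t. ennreal_powr (g x t * inverse (ennreal_powr (N t) (1 / q))) p \<partial>M2) (1 / p) *
        ennreal_powr (\<integral>\<^sup>+t. ennreal_powr (ennreal_powr (N t) (1 / q)) q \<partial>M2) (1 / q)"
      by (rule Holder_nn_integral[OF p q(1,2)]) measurable
    also have "\<dots> = ennreal_powr (\<integral>\<^sup>+t. ennreal_powr (g x t) p * inverse (ennreal_powr (N t) (p - 1)) \<partial>M2) (1 / p) *
        ennreal_powr ?A (1 / q)"
      using q by (simp add: ennreal_powr_mult ennreal_powr_inverse ennreal_powr_powr A)
    finally have "ennreal_powr (\<integral>\<^sup>+t. g x t \<partial>M2) p \<le> ennreal_powr (\<dots>) p"
      using p by (intro ennreal_powr_mono) simp_all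
    then show ?case
      using p q by (simp add: ennreal_powr_mult ennreal_powr_powr)
  qed
  then have "(\<integral>\<^sup>+x. ennreal_powr (\<integral>\<^sup>+t. g x t \<partial>M2) p \<partial>M1) \<le>
      (\<integral>\<^sup>+x. (\<integral>\<^sup>+t. ennreal_powr (g x t) p * inverse (ennreal_powr (N t) (p - 1)) \<partial>M2) *
        ennreal_powr ?A (p - 1) \<partial>M1)"
    by (rule nn_integral_mono_AE)
  also have "\<dots> = (\<integral>\<^sup>+x. (\<integral>\<^sup>+t. ennreal_powr (g x t) p * inverse (ennreal_powr (N t) (p - 1)) \<partial>M2) \<partial>M1) *
      ennreal_powr ?A (p - 1)"
    by (rule nn_integral_multc) measurable
  also have "(\<integral>\<^sup>+x. (\<integral>\<^sup>+t. ennreal_powr (g x t) p * inverse (ennreal_powr (N t) (p - 1)) \<partial>M2) \<partial>M1) =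
      (\<integral>\<^sup>+t. (\<integral>\<^sup>+x. ennreal_powr (g x t) p * inverse (ennreal_powr (N t) (p - 1)) \<partial>M1) \<partial>M2)"
    by (rule Fubini'[symmetric]) measurable
  also have "\<dots> = (\<integral>\<^sup>+t. ennreal_powr (N t) p * inverse (ennreal_powr (N t) (p - 1)) \<partial>M2)"
    by (intro nn_integral_cong) (simp add: nn_integral_multc Np)
  also have "\<dots> \<le> (\<integral>\<^sup>+t. N t \<partial>M2)"
  proof (rule nn_integral_mono)
    fix t
    have "ennreal_powr (N t) p = N t * ennreal_powr (N t) (p - 1)"
      using ennreal_powr_add[of "N t" 1 "p - 1"] by simp
    then have "ennreal_powr (N t) p * inverse (ennreal_powr (N t) (p - 1)) =
        N t * (inverse (ennreal_powr (N t) (p - 1)) * ennreal_powr (N t) (p - 1))"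
      by (simp only: mult_ac)
    also have "\<dots> \<le> N t * 1"
      by (intro mult_left_mono ennreal_inverse_mult_self_le_one) simp
    finally show "ennreal_powr (N t) p * inverse (ennreal_powr (N t) (p - 1)) \<le> N t"
      by simp
  qed
  also have "(\<integral>\<^sup>+t. N t \<partial>M2) * ennreal_powr ?A (p - 1) = ennreal_powr ?A p"
    using ennreal_powr_add[of ?A 1 "p - 1"] by (simp add: A)
  finally have "(\<integral>\<^sup>+x. ennreal_powr (\<integral>\<^sup>+t. g x t \<partial>M2) p \<partial>M1) \<le> ennreal_powr ?A p"
    by (simp add: mult_right_mono)
  then have "ennreal_powr (\<integral>\<^sup>+x. ennreal_powr (\<integral>\<^sup>+t. g x t \<partial>M2) p \<partial>M1) (1 / p) \<le>
      ennreal_powr (ennreal_powr ?A p) (1 / p)"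
    using p by (intro ennreal_powr_mono) simp_all
  then show ?thesis
    using p by (simp add: ennreal_powr_powr)
qed simp

end

section \<open>Null sets, Borel versions and lower integrals\<close>

lemma AE_lebesgue_null_cover:
  assumes "AE x in lebesgue. P x"
  shows "\<exists>N \<in> null_sets (lborel :: 'a::euclidean_space measure). \<forall>x. x \<notin> N \<longrightarrow> P x"
proof -
  have "AE x in lborel. P x"
    using assms by (simp add: AE_completion_iff)
  then show ?thesis
    unfolding eventually_ae_filter by auto
qed

lemma AE_lebesgue_dilation:
  fixes c :: real
  assumes "c \<noteq> 0" "AE x in lebesgue. P x"
  shows "AE x in lebesgue. P (c * x)"
proof -
  obtain N where N: "N \<in> null_sets (lborel :: real measure)" "\<And>x. x \<notin> N \<Longrightarrow> P x"
    using AE_lebesgue_null_cover[OF assms(2)] by blast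
  have [measurable]: "N \<in> sets borel"
    using N(1) by (simp add: null_sets_def)
  have "AE x in lborel. 0 + c * x \<notin> N"
    using AE_not_in[OF N(1)] by (intro AE_borel_affine assms) simp_all
  then have "AE x in lborel. P (c * x)"
    by eventually_elim (simp add: N(2))
  then show ?thesis
    by (simp add: AE_completion_iff)
qed

text \<open>
  Away from the origin \<open>t \<mapsto> x / t\<close> is a differentiable involution, so the preimage of a null set
  is also its image, and differentiable maps send null sets to null sets.
\<close>

lemma AE_lebesgue_inversion:
  fixes x :: real
  assumes "x \<noteq> 0" "AE s in lebesgue. P s"
  shows "AE t in lebesgue. P (x / t)"
proof -
  obtain N where N: "N \<in> null_sets (lborel :: real measure)" "\<And>x. x \<notin> N \<Longrightarrow> P x"
    using AE_lebesgue_null_cover[OF assms(2)] by blast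
  have "N - {0} \<in> null_sets lebesgue"
    by (intro null_set_Diff null_sets_completionI N) simp
  then have "negligible ((\<lambda>s. x / s) ` (N - {0}))"
    unfolding negligible_iff_null_sets[symmetric]
    by (rule negligible_differentiable_image_negligible[OF order_refl])
       (auto intro!: derivative_intros simp: differentiable_on_def)
  then have "AE t in lebesgue. t \<notin> insert 0 ((\<lambda>s. x / s) ` (N - {0}))"
    by (intro AE_not_in) (simp add: negligible_iff_null_sets[symmetric])
  then show ?thesis
  proof eventually_elim
    case (elim t)
    have "x / t \<notin> N"
    proof
      assume "x / t \<in> N"
      then have "x / t \<in> N - {0}" "t = x / (x / t)"
        using elim assms(1) by auto
      then show False
        using elim by blast
    qed
    then show ?case
      by (rule N(2))
  qed
qed

lemma lebesgue_measurable_complex_borel_version: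
  fixes f :: "real \<Rightarrow> complex"
  assumes "f \<in> borel_measurable lebesgue"
  obtains g where "g \<in> borel_measurable borel" "AE x in lebesgue. f x = g x"
proof -
  have "(\<lambda>x. Re (f x)) \<in> borel_measurable lebesgue" "(\<lambda>x. Im (f x)) \<in> borel_measurable lebesgue"
    using assms by measurable
  then obtain r i where [measurable]: "r \<in> borel_measurable lborel" "i \<in> borel_measurable lborel"
    and "AE x in lborel. Re (f x) = r x" "AE x in lborel. Im (f x) = i x"
    by (metis completion_ex_borel_measurable_real)
  then have "AE x in lborel. f x = Complex (r x) (i x)"
    by (auto simp: complex_eq_iff)
  moreover have "(\<lambda>x. Complex (r x) (i x)) \<in> borel_measurable borel"
    unfolding Complex_eq by measurable
  ultimately show ?thesis
    using that by (simp add: AE_completion_iff)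
qed

text \<open>
  Here \<open>h\<close> is arbitrary, so its integral is a lower integral, and the rule for pulling out a
  constant does not apply to \<open>h\<close>. It does apply to the measurable \<open>f\<close>, so the constant is divided
  out of \<open>f\<close> instead.
\<close>

lemma nn_integral_le_multc:
  assumes [measurable]: "f \<in> borel_measurable M"
    and "AE x in M. f x \<le> h x * c" "c \<noteq> top"
  shows "(\<integral>\<^sup>+x. f x \<partial>M) \<le> (\<integral>\<^sup>+x. h x \<partial>M) * c"
proof (cases "c = 0")
  case True
  then have "(\<integral>\<^sup>+x. f x \<partial>M) = 0"
    using assms(2) by (simp add: nn_integral_0_iff_AE)
  then show ?thesis by simp
next
  case False
  have le: "AE x in M. f x / c \<le> h x"
    using assms(2)
  proof eventually_elim
    case (elim x)
    then have "f x / c \<le> h x * c / c"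
      by (rule divide_right_mono_ennreal)
    then show ?case
      using False assms(3) by (simp add: mult_divide_eq_ennreal)
  qed
  have "(\<integral>\<^sup>+x. f x \<partial>M) / c = (\<integral>\<^sup>+x. f x / c \<partial>M)"
    by (simp add: nn_integral_divide)
  also have "\<dots> \<le> (\<integral>\<^sup>+x. h x \<partial>M)"
    using le by (rule nn_integral_mono_AE)
  finally have "(\<integral>\<^sup>+x. f x \<partial>M) / c * c \<le> (\<integral>\<^sup>+x. h x \<partial>M) * c"
    by (rule mult_right_mono) simp
  moreover have "c / c = 1"
    using False assms(3) by (intro ennreal_divide_self) (simp_all add: less_top)
  ultimately show ?thesis
    by (simp add: ennreal_divide_times)
qed

section \<open>Averages of dilations\<close>

lemma weighted_norm_dilation_le:
  fixes F V :: "real \<Rightarrow> ennreal"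
  assumes "t \<noteq> 0" and [measurable]: "F \<in> borel_measurable borel" "V \<in> borel_measurable borel"
    and V: "AE y in lborel. V (t * y) \<le> S * V y"
  shows "(\<integral>\<^sup>+x. F (x / t) * V x \<partial>lborel) \<le> ennreal \<bar>t\<bar> * S * (\<integral>\<^sup>+y. F y * V y \<partial>lborel)"
proof -
  have "(\<integral>\<^sup>+x. F (x / t) * V x \<partial>lborel) = ennreal \<bar>t\<bar> * (\<integral>\<^sup>+y. F y * V (t * y) \<partial>lborel)"
    using \<open>t \<noteq> 0\<close> by (subst nn_integral_real_affine[where c = t and t = 0]) simp_all
  also have "(\<integral>\<^sup>+y. F y * V (t * y) \<partial>lborel) \<le> (\<integral>\<^sup>+y. S * (F y * V y) \<partial>lborel)"
  proof (rule nn_integral_mono_AE)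
    show "AE y in lborel. F y * V (t * y) \<le> S * (F y * V y)"
      using V
    proof eventually_elim
      case (elim y)
      then have "F y * V (t * y) \<le> F y * (S * V y)"
        by (rule mult_left_mono) simp
      then show ?case by (simp add: mult_ac)
    qed
  qed
  also have "\<dots> = S * (\<integral>\<^sup>+y. F y * V y \<partial>lborel)"
    by (rule nn_integral_cmult) measurable
  finally show ?thesis
    by (simp add: mult_left_mono mult.assoc)
qed

text \<open>
  This is the theorem for nonnegative Borel functions. Minkowski's inequality is used with Lebesgue
  measure in both variables, the weight entering as the factor \<open>V powr (1 / p)\<close> of the integrand.
\<close>

lemma weighted_average_of_dilations_le:
  fixes F K V S :: "real \<Rightarrow> ennreal"
  assumes p: "1 < p"
    and [measurable]: "F \<in> borel_measurable borel" "K \<in> borel_measurable borel"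
      "V \<in> borel_measurable borel"
    and V: "\<And>t. t \<noteq> 0 \<Longrightarrow> AE y in lborel. V (t * y) \<le> S t * V y"
    and fin: "(\<integral>\<^sup>+y. ennreal_powr (F y) p * V y \<partial>lborel) \<noteq> top"
  shows "ennreal_powr (\<integral>\<^sup>+x. ennreal_powr (\<integral>\<^sup>+t. K t * F (x / t) \<partial>lborel) p * V x \<partial>lborel) (1 / p) \<le>
    (\<integral>\<^sup>+t. K t * ennreal_powr (ennreal \<bar>t\<bar>) (1 / p) * ennreal_powr (S t) (1 / p) \<partial>lborel) *
    ennreal_powr (\<integral>\<^sup>+y. ennreal_powr (F y) p * V y \<partial>lborel) (1 / p)"
    (is "_ \<le> _ * ennreal_powr ?I _")
proof -
  define g where "g x t = K t * F (x / t) * ennreal_powr (V x) (1 / p)" for x t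
  have g_meas [measurable]: "case_prod g \<in> borel_measurable (lborel \<Otimes>\<^sub>M lborel)"
    unfolding g_def by measurable
  have gp: "ennreal_powr (g x t) p = ennreal_powr (K t) p * (ennreal_powr (F (x / t)) p * V x)" for x t
    using p by (simp add: g_def ennreal_powr_mult ennreal_powr_powr mult.assoc)
  have "ennreal_powr (\<integral>\<^sup>+t. g x t \<partial>lborel) p =
      ennreal_powr (\<integral>\<^sup>+t. K t * F (x / t) \<partial>lborel) p * V x" for x
    using p by (simp add: g_def nn_integral_multc ennreal_powr_mult ennreal_powr_powr)
  then have "ennreal_powr (\<integral>\<^sup>+x. ennreal_powr (\<integral>\<^sup>+t. K t * F (x / t) \<partial>lborel) p * V x \<partial>lborel) (1 / p) =
      ennreal_powr (\<integral>\<^sup>+x. ennreal_powr (\<integral>\<^sup>+t. g x t \<partial>lborel) p \<partial>lborel) (1 / p)"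
    by simp
  also have "\<dots> \<le> (\<integral>\<^sup>+t. ennreal_powr (\<integral>\<^sup>+x. ennreal_powr (g x t) p \<partial>lborel) (1 / p) \<partial>lborel)"
    using p g_meas by (rule lborel_pair.Minkowski_nn_integral)
  also have "\<dots> \<le>
      (\<integral>\<^sup>+t. K t * ennreal_powr (ennreal \<bar>t\<bar>) (1 / p) * ennreal_powr (S t) (1 / p) \<partial>lborel) *
      ennreal_powr ?I (1 / p)"
  proof (rule nn_integral_le_multc)
    show "AE t in lborel. ennreal_powr (\<integral>\<^sup>+x. ennreal_powr (g x t) p \<partial>lborel) (1 / p) \<le>
        K t * ennreal_powr (ennreal \<bar>t\<bar>) (1 / p) * ennreal_powr (S t) (1 / p) * ennreal_powr ?I (1 / p)"
      using AE_lborel_singleton[of "0::real"]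
    proof eventually_elim
      case (elim t)
      have "(\<integral>\<^sup>+x. ennreal_powr (g x t) p \<partial>lborel) =
          ennreal_powr (K t) p * (\<integral>\<^sup>+x. ennreal_powr (F (x / t)) p * V x \<partial>lborel)"
        unfolding gp by (rule nn_integral_cmult) measurable
      also have "\<dots> \<le> ennreal_powr (K t) p * (ennreal \<bar>t\<bar> * S t * ?I)"
        by (intro mult_left_mono weighted_norm_dilation_le elim V) simp_all
      finally have "ennreal_powr (\<integral>\<^sup>+x. ennreal_powr (g x t) p \<partial>lborel) (1 / p) \<le>
          ennreal_powr (ennreal_powr (K t) p * (ennreal \<bar>t\<bar> * S t * ?I)) (1 / p)"
        using p by (intro ennreal_powr_mono) simp_all
      also have "\<dots> = K t * ennreal_powr (ennreal \<bar>t\<bar>) (1 / p) * ennreal_powr (S t) (1 / p) *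
          ennreal_powr ?I (1 / p)"
        using p by (simp add: ennreal_powr_mult ennreal_powr_powr mult.assoc)
      finally show ?case .
    qed
  qed (use fin in simp_all)
  finally show ?thesis .
qed

section \<open>The Dunkl-Hausdorff operator\<close>

lemma borel_measurable_dunkl_hausdorff_integrand:
  assumes [measurable]: "\<phi> \<in> borel_measurable borel" "f \<in> borel_measurable borel"
  shows "(\<lambda>(x, t). dunkl_hausdorff_integrand \<alpha> \<phi> f x t) \<in> borel_measurable (borel \<Otimes>\<^sub>M lborel)"
  unfolding dunkl_hausdorff_integrand_def by measurable

lemma dunkl_hausdorff_borel_versions:
  fixes f F \<phi> \<Phi> :: "real \<Rightarrow> complex"
  assumes meas [measurable]: "\<Phi> \<in> borel_measurable borel" "F \<in> borel_measurable borel"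
    and \<phi>: "AE t in lebesgue. \<phi> t = \<Phi> t" and f: "AE y in lebesgue. f y = F y"
    and x: "x \<noteq> 0"
  shows "integrable lebesgue (dunkl_hausdorff_integrand \<alpha> \<phi> f x) \<longleftrightarrow>
      integrable lborel (dunkl_hausdorff_integrand \<alpha> \<Phi> F x)" (is ?int)
    and "dunkl_hausdorff \<alpha> \<phi> f x = (LINT t|lborel. dunkl_hausdorff_integrand \<alpha> \<Phi> F x t)" (is ?eq)
proof -
  have borel: "dunkl_hausdorff_integrand \<alpha> \<Phi> F x \<in> borel_measurable lborel"
    using measurable_Pair2[OF borel_measurable_dunkl_hausdorff_integrand[OF meas], of x] by simp
  then have lebesgue: "dunkl_hausdorff_integrand \<alpha> \<Phi> F x \<in> borel_measurable lebesgue"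
    by (rule measurable_completion)
  have ae: "AE t in lebesgue. dunkl_hausdorff_integrand \<alpha> \<Phi> F x t = dunkl_hausdorff_integrand \<alpha> \<phi> f x t"
    using \<phi> AE_lebesgue_inversion[OF x f]
    by eventually_elim (simp add: dunkl_hausdorff_integrand_def)
  note meas' = borel_measurable_AE[OF lebesgue ae]
  show ?int
    using integrable_cong_AE[OF lebesgue meas' ae] integrable_completion[OF borel] by simp
  show ?eq
    using integral_cong_AE[OF lebesgue meas' ae] integral_completion[OF borel]
    by (simp add: dunkl_hausdorff_def)
qed

text \<open>
  The quotient conventions at \<open>0\<close> and \<open>\<infinity>\<close> do not interfere: \<open>v(t y) / v(y) \<cdot> v(y) = v(t y)\<close> holds
  whenever \<open>v(y)\<close> is positive and finite, whatever \<open>v(t y)\<close> is.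
\<close>

lemma weight_dilation_le_SUP:
  assumes v: "weight_function v" and V: "AE x in lebesgue. v x = V x" and "t \<noteq> 0"
  shows "AE y in lborel. V (t * y) \<le> (SUP y. v (t * y) / v y) * V y"
proof -
  have "AE y in lebesgue. 0 < v y \<and> v y < \<infinity>"
    using v by (simp add: weight_function_def)
  then have "AE y in lebesgue. V (t * y) \<le> (SUP y. v (t * y) / v y) * V y"
    using V AE_lebesgue_dilation[OF \<open>t \<noteq> 0\<close> V]
  proof eventually_elim
    case (elim y)
    have "v y / v y = 1"
      using elim(1) by (intro ennreal_divide_self) auto
    then have "v (t * y) = v (t * y) / v y * v y"
      by (simp add: ennreal_divide_times)
    also have "\<dots> \<le> (SUP y. v (t * y) / v y) * v y"
      by (intro mult_right_mono SUP_upper) simp_all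
    finally show ?case
      using elim by simp
  qed
  then show ?thesis
    by (simp add: AE_completion_iff)
qed

text \<open>
  The exponent \<open>2\<alpha> + 2 - 1 / p\<close> in \<open>A_sup\<close> splits into the kernel of the operator and the factor
  \<open>|t| powr (1 / p)\<close> that a dilation by \<open>t\<close> contributes to an \<open>L\<^sup>p\<close> norm.
\<close>

lemma A_sup_eq:
  assumes "AE t in lebesgue. \<phi> t = \<Phi> t"
  shows "A_sup \<alpha> p v \<phi> =
    (\<integral>\<^sup>+t. ennreal (norm (\<Phi> t) / \<bar>t\<bar> powr (2 * \<alpha> + 2)) * ennreal_powr (ennreal \<bar>t\<bar>) (1 / p) *
      ennreal_powr (SUP y. v (t * y) / v y) (1 / p) \<partial>lborel)"
  unfolding A_sup_def nn_integral_completion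
proof (rule nn_integral_cong_AE)
  have "AE t in lborel. \<phi> t = \<Phi> t"
    using assms by (simp add: AE_completion_iff)
  then show "AE t in lborel. ennreal (norm (\<phi> t) / \<bar>t\<bar> powr (2 * \<alpha> + 2 - 1 / p)) *
        ennreal_powr (SUP y. v (t * y) / v y) (1 / p) =
      ennreal (norm (\<Phi> t) / \<bar>t\<bar> powr (2 * \<alpha> + 2)) * ennreal_powr (ennreal \<bar>t\<bar>) (1 / p) *
        ennreal_powr (SUP y. v (t * y) / v y) (1 / p)"
    by eventually_elim (simp add: ennreal_powr_ennreal powr_diff flip: ennreal_mult)
qed

text \<open>
  The bound on the average \<open>G\<close> of the dilates of \<open>|f|\<close> gives everything: \<open>G\<close> has finite weighted
  norm and the weight is positive almost everywhere, so \<open>G\<close> is finite almost everywhere. This is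
  absolute convergence, and \<open>G\<close> then dominates \<open>|H f|\<close>.
\<close>

lemma dunkl_hausdorff_estimate:
  fixes p \<alpha> :: real and v :: "real \<Rightarrow> ennreal" and \<phi> f :: "real \<Rightarrow> complex"
  assumes p: "1 < p" and v: "weight_function v" and \<phi>: "\<phi> \<in> borel_measurable lebesgue"
    and A: "A_sup \<alpha> p v \<phi> < \<infinity>" and f: "f \<in> Lpv p v"
  shows "AE x in lebesgue. integrable lebesgue (dunkl_hausdorff_integrand \<alpha> \<phi> f x)" (is ?int)
    and "dunkl_hausdorff \<alpha> \<phi> f \<in> borel_measurable lebesgue" (is ?meas)
    and "Lpv_norm p v (dunkl_hausdorff \<alpha> \<phi> f) \<le> A_sup \<alpha> p v \<phi> * Lpv_norm p v f" (is ?bound)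
proof -
  obtain \<Phi> where [measurable]: "\<Phi> \<in> borel_measurable borel" and \<Phi>: "AE t in lebesgue. \<phi> t = \<Phi> t"
    using lebesgue_measurable_complex_borel_version[OF \<phi>] by blast
  have "f \<in> borel_measurable lebesgue"
    using f by (simp add: Lpv_def)
  then obtain F where [measurable]: "F \<in> borel_measurable borel" and F: "AE y in lebesgue. f y = F y"
    using lebesgue_measurable_complex_borel_version by blast
  obtain V where [measurable]: "V \<in> borel_measurable borel" and V: "AE x in lebesgue. v x = V x"
    using v completion_ex_borel_measurable[of v lborel]
    by (auto simp: weight_function_def AE_completion_iff)
  define J where "J x t = dunkl_hausdorff_integrand \<alpha> \<Phi> F x t" for x t
  define K where "K t = ennreal (norm (\<Phi> t) / \<bar>t\<bar> powr (2 * \<alpha> + 2))" for t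
  define G where "G x = (\<integral>\<^sup>+t. K t * ennreal (norm (F (x / t))) \<partial>lborel)" for x
  have [measurable]: "K \<in> borel_measurable borel"
    unfolding K_def by measurable
  have [measurable]: "G \<in> borel_measurable borel"
    unfolding G_def by measurable
  have J_meas [measurable]: "case_prod J \<in> borel_measurable (borel \<Otimes>\<^sub>M lborel)"
    unfolding J_def by (rule borel_measurable_dunkl_hausdorff_integrand) simp_all
  have norm_J: "(\<integral>\<^sup>+t. ennreal (norm (J x t)) \<partial>lborel) = G x" for x
    unfolding J_def G_def K_def dunkl_hausdorff_integrand_def
    by (intro nn_integral_cong) (simp add: norm_mult norm_divide flip: ennreal_mult)
  have x_nz: "AE x in lebesgue. x \<noteq> (0::real)"
    by (simp add: AE_completion_iff AE_lborel_singleton)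
  have H_eq: "AE x in lebesgue. (LINT t|lborel. J x t) = dunkl_hausdorff \<alpha> \<phi> f x"
    using x_nz by eventually_elim (simp add: J_def dunkl_hausdorff_borel_versions(2)[OF _ _ \<Phi> F])
  have int_iff: "AE x in lebesgue. integrable lebesgue (dunkl_hausdorff_integrand \<alpha> \<phi> f x) \<longleftrightarrow>
      integrable lborel (J x)"
    using x_nz by eventually_elim (simp add: J_def[abs_def] dunkl_hausdorff_borel_versions(1)[OF _ _ \<Phi> F])
  have J_int_meas: "(\<lambda>x. LINT t|lborel. J x t) \<in> borel_measurable borel"
    by measurable
  then have "(\<lambda>x. LINT t|lborel. J x t) \<in> borel_measurable lebesgue"
    by (intro measurable_completion) simp
  then show ?meas
    using H_eq by (rule borel_measurable_AE)

  have f_norm: "(\<integral>\<^sup>+y. ennreal_powr (ennreal (norm (F y))) p * V y \<partial>lborel) =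
      (\<integral>\<^sup>+y. ennreal (norm (f y) powr p) * v y \<partial>lebesgue)"
    unfolding nn_integral_completion[of lborel, symmetric] using F V
    by (intro nn_integral_cong_AE, eventually_elim) (simp add: ennreal_powr_ennreal)
  have f_fin: "(\<integral>\<^sup>+y. ennreal_powr (ennreal (norm (F y))) p * V y \<partial>lborel) \<noteq> top"
    using f unfolding f_norm by (auto simp: Lpv_def Lpv_norm_def)
  have main: "ennreal_powr (\<integral>\<^sup>+x. ennreal_powr (G x) p * V x \<partial>lborel) (1 / p) \<le>
      A_sup \<alpha> p v \<phi> * Lpv_norm p v f"
    using weighted_average_of_dilations_le[OF p, of "\<lambda>y. ennreal (norm (F y))" K V,
        OF _ _ _ weight_dilation_le_SUP[OF v V] f_fin]
    by (simp add: G_def Lpv_norm_def f_norm A_sup_eq[OF \<Phi>] K_def)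
  also have "\<dots> < top"
    using A f by (auto simp: Lpv_def ennreal_mult_less_top)
  finally have "(\<integral>\<^sup>+x. ennreal_powr (G x) p * V x \<partial>lborel) \<noteq> top"
    by auto
  then have "AE x in lebesgue. ennreal_powr (G x) p * V x \<noteq> top"
    using nn_integral_PInf_AE[of "\<lambda>x. ennreal_powr (G x) p * V x" lborel]
    by (simp add: AE_completion_iff)
  moreover have "AE x in lebesgue. 0 < v x \<and> v x < \<infinity>"
    using v by (simp add: weight_function_def)
  ultimately have "AE x in lebesgue. G x < top"
    using V by eventually_elim (auto simp: ennreal_mult_eq_top_iff less_top)
  then have J_int: "AE x in lebesgue. integrable lborel (J x)"
    by eventually_elim (simp add: integrable_iff_bounded norm_J)
  with int_iff show ?int
    by eventually_elim simp

  have "AE x in lebesgue. ennreal (norm (dunkl_hausdorff \<alpha> \<phi> f x) powr p) * v x \<le>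
      ennreal_powr (G x) p * V x"
    using H_eq J_int V
  proof eventually_elim
    case (elim x)
    have "ennreal (norm (dunkl_hausdorff \<alpha> \<phi> f x)) \<le> G x"
      using integral_norm_bound_ennreal[OF elim(2)] elim(1) by (simp add: norm_J)
    then have "ennreal_powr (ennreal (norm (dunkl_hausdorff \<alpha> \<phi> f x))) p \<le> ennreal_powr (G x) p"
      using p by (intro ennreal_powr_mono) simp_all
    then show ?case
      using elim(3) by (simp add: ennreal_powr_ennreal mult_right_mono)
  qed
  then have "(\<integral>\<^sup>+x. ennreal (norm (dunkl_hausdorff \<alpha> \<phi> f x) powr p) * v x \<partial>lebesgue) \<le>
      (\<integral>\<^sup>+x. ennreal_powr (G x) p * V x \<partial>lebesgue)"
    by (rule nn_integral_mono_AE)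
  then have "Lpv_norm p v (dunkl_hausdorff \<alpha> \<phi> f) \<le>
      ennreal_powr (\<integral>\<^sup>+x. ennreal_powr (G x) p * V x \<partial>lborel) (1 / p)"
    unfolding Lpv_norm_def nn_integral_completion using p by (intro ennreal_powr_mono) simp_all
  also note main
  finally show ?bound .
qed

theorem theorem2p1:
  fixes p \<alpha> :: real and v :: "real \<Rightarrow> ennreal" and \<phi> :: "real \<Rightarrow> complex"
  assumes "1 < p"
    and "weight_function v"
    and "integrable lebesgue \<phi>"
    and "A_sup \<alpha> p v \<phi> < \<infinity>"
  shows "bounded_operator_Lpv p v (dunkl_hausdorff \<alpha> \<phi>) \<and>
    (\<forall>f\<in>Lpv p v.
       (AE x in lebesgue. integrable lebesgue (dunkl_hausdorff_integrand \<alpha> \<phi> f x)) \<and>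
       Lpv_norm p v (dunkl_hausdorff \<alpha> \<phi> f) \<le> A_sup \<alpha> p v \<phi> * Lpv_norm p v f)"
proof -
  let ?T = "dunkl_hausdorff \<alpha> \<phi>"
  have \<phi>: "\<phi> \<in> borel_measurable lebesgue"
    using assms(3) by (rule borel_measurable_integrable)
  note est = dunkl_hausdorff_estimate[OF assms(1,2) \<phi> assms(4)]
  have maps: "?T f \<in> Lpv p v" if f: "f \<in> Lpv p v" for f
  proof -
    have "A_sup \<alpha> p v \<phi> * Lpv_norm p v f < \<infinity>"
      using f assms(4) by (simp add: Lpv_def ennreal_mult_less_top)
    then show ?thesis
      using est(2,3)[OF f] by (auto simp: Lpv_def intro: le_less_trans)
  qed
  have cong: "AE x in lebesgue. ?T f x = ?T g x"
    if f: "f \<in> Lpv p v" and g: "g \<in> Lpv p v" and fg: "AE x in lebesgue. f x = g x" for f g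
  proof -
    obtain \<Phi> where \<Phi>: "\<Phi> \<in> borel_measurable borel" "AE t in lebesgue. \<phi> t = \<Phi> t"
      using lebesgue_measurable_complex_borel_version[OF \<phi>] by blast
    have "f \<in> borel_measurable lebesgue"
      using f by (simp add: Lpv_def)
    then obtain F where F: "F \<in> borel_measurable borel" "AE y in lebesgue. f y = F y"
      using lebesgue_measurable_complex_borel_version by blast
    have gF: "AE y in lebesgue. g y = F y"
      using fg F(2) by eventually_elim simp
    have "AE x in lebesgue. x \<noteq> (0::real)"
      by (simp add: AE_completion_iff AE_lborel_singleton)
    then show ?thesis
      by eventually_elim
         (simp add: dunkl_hausdorff_borel_versions(2)[OF \<Phi>(1) F(1) \<Phi>(2) F(2)]
           dunkl_hausdorff_borel_versions(2)[OF \<Phi>(1) F(1) \<Phi>(2) gF])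
  qed
  have add: "AE x in lebesgue. ?T (\<lambda>y. f y + g y) x = ?T f x + ?T g x"
    if "f \<in> Lpv p v" "g \<in> Lpv p v" for f g
    using est(1)[OF that(1)] est(1)[OF that(2)]
  proof eventually_elim
    case (elim x)
    have "dunkl_hausdorff_integrand \<alpha> \<phi> (\<lambda>y. f y + g y) x =
        (\<lambda>t. dunkl_hausdorff_integrand \<alpha> \<phi> f x t + dunkl_hausdorff_integrand \<alpha> \<phi> g x t)"
      by (simp add: fun_eq_iff dunkl_hausdorff_integrand_def distrib_left)
    then show ?case
      using elim by (simp add: dunkl_hausdorff_def)
  qed
  have scale: "?T (\<lambda>y. c * f y) x = c * ?T f x" for c f x
  proof -
    have "dunkl_hausdorff_integrand \<alpha> \<phi> (\<lambda>y. c * f y) x =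
        (\<lambda>t. c * dunkl_hausdorff_integrand \<alpha> \<phi> f x t)"
      by (simp add: fun_eq_iff dunkl_hausdorff_integrand_def)
    then show ?thesis
      by (simp add: dunkl_hausdorff_def)
  qed
  have "\<exists>C::real. 0 \<le> C \<and> (\<forall>f\<in>Lpv p v. Lpv_norm p v (?T f) \<le> ennreal C * Lpv_norm p v f)"
    using est(3) assms(4) by (intro exI[of _ "enn2real (A_sup \<alpha> p v \<phi>)"]) simp
  then show ?thesis
    unfolding bounded_operator_Lpv_def using maps cong add scale est(1,3) by simp
qed

end
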